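(* Let $G$ be a graph with $n$ vertices and let $k\geq 1$ be an integer with $n\geq k+1$. Then $$\omega(F_k(G))=\min\{\omega(G),\ \max\{n-k+1,\,k+1\}\}.$$
   Context: Graphs are finite, simple and undirected. For a graph $G$ and an integer $k\geq 1$, the $k$-token graph $F_k(G)$ is the graph whose vertices are the $k$-element subsets of $V(G)$, where two vertices $A,B$ are adjacent whenever their symmetric difference $A\triangle B$ is a pair $\{a,b\}$ with $a\in A$, $b\in B$ and $ab\in E(G)$. The clique number $\omega(G)$ is the maximum cardinality of a set of pairwise adjacent vertices of $G$. *)

theory Defs
  imports "Graph_Theory.Pair_Digraph"
begin

text \<open>
  A finite simple undirected graph is a \<^locale>\<open>pair_graph\<close>: finitely many vertices, and a symmetric,
  loop-free set of arcs, each edge being represented by its two orientations.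
\<close>

definition token_graph :: "nat \<Rightarrow> 'a pair_pre_digraph \<Rightarrow> 'a set pair_pre_digraph" where
  "token_graph k G =
    \<lparr> pverts = {A. A \<subseteq> pverts G \<and> card A = k},
      parcs = {(A, B). A \<subseteq> pverts G \<and> card A = k \<and> B \<subseteq> pverts G \<and> card B = k \<and>
                 (\<exists>a\<in>A. \<exists>b\<in>B. sym_diff A B = {a, b} \<and> (a, b) \<in> parcs G)} \<rparr>"

definition is_clique :: "'a pair_pre_digraph \<Rightarrow> 'a set \<Rightarrow> bool" where
  "is_clique G C \<longleftrightarrow>
    C \<subseteq> pverts G \<and> (\<forall>u\<in>C. \<forall>v\<in>C. u \<noteq> v \<longrightarrow> (u, v) \<in> parcs G)"

definition clique_number :: "'a pair_pre_digraph \<Rightarrow> nat" where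
  "clique_number G = Max {card C | C. is_clique G C}"

lemma pair_graph_token_graph:
  assumes "pair_graph G"
  shows "pair_graph (token_graph k G)"
proof -
  interpret pair_graph G by fact
  have fin: "finite {A. A \<subseteq> pverts G \<and> card A = k}"
    by (rule finite_subset[of _ "Pow (pverts G)"]) auto
  have arcs: "parcs (token_graph k G) \<subseteq> pverts (token_graph k G) \<times> pverts (token_graph k G)"
    by (auto simp: token_graph_def)
  have flip: "(B, A) \<in> parcs (token_graph k G)" if AB: "(A, B) \<in> parcs (token_graph k G)" for A B
  proof -
    from AB obtain a b where ab: "a \<in> A" "b \<in> B" "sym_diff A B = {a, b}" "(a, b) \<in> parcs G"
      unfolding token_graph_def by auto
    have "(b, a) \<in> parcs G"
      using ab(4) by (rule arcs_symmetric)
    moreover have "sym_diff B A = {b, a}"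
      using ab(3) by (simp add: Un_commute insert_commute)
    ultimately have "\<exists>b\<in>B. \<exists>a\<in>A. sym_diff B A = {b, a} \<and> (b, a) \<in> parcs G"
      using ab(1,2) by blast
    with AB show ?thesis
      by (simp add: token_graph_def)
  qed
  have finite_arcs: "finite (parcs (token_graph k G))"
    by (rule finite_subset[OF arcs]) (simp add: token_graph_def fin)
  have loopfree: "A \<noteq> B" if "(A, B) \<in> parcs (token_graph k G)" for A B
    using that unfolding token_graph_def by auto
  show ?thesis
  proof
    show "finite (pverts (token_graph k G))"
      by (simp add: token_graph_def fin)
    show "finite (parcs (token_graph k G))"
      by (fact finite_arcs)
    show "symmetric (with_proj (token_graph k G))"
      unfolding symmetric_def by (rule symI) (simp add: flip)
    show "fst e \<in> pverts (token_graph k G)" "snd e \<in> pverts (token_graph k G)"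
      if "e \<in> parcs (token_graph k G)" for e
      using arcs that by auto
    show "fst e \<noteq> snd e" if "e \<in> parcs (token_graph k G)" for e
      using loopfree[of "fst e" "snd e"] that by simp
  qed
qed

lemma is_clique_card_set:
  assumes "pair_graph G"
  shows "finite {card C | C. is_clique G C}" and "{card C | C. is_clique G C} \<noteq> {}"
proof -
  interpret pair_graph G by fact
  have "{C. is_clique G C} \<subseteq> Pow (pverts G)"
    by (auto simp: is_clique_def)
  then have "finite {C. is_clique G C}"
    by (rule finite_subset) simp
  then show "finite {card C | C. is_clique G C}"
    by simp
  have "is_clique G {}"
    by (simp add: is_clique_def)
  then show "{card C | C. is_clique G C} \<noteq> {}"
    by blast
qed

end

theory Submission
  imports Defs
begin

text \<open>
  Two distinct vertices \<open>A\<close>, \<open>B\<close> of a clique of the token graph span the sets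
  \<open>A \<inter> B\<close> and \<open>A \<union> B\<close>. Either every member of the clique contains \<open>A \<inter> B\<close>, or every member
  is contained in \<open>A \<union> B\<close>. So the clique has the form \<open>{S \<union> {x} | x \<in> D}\<close> with \<open>D\<close> disjoint from
  \<open>S\<close>, or \<open>{T - {x} | x \<in> D}\<close> with \<open>D \<subseteq> T\<close>, where \<open>D\<close> is a clique of \<open>G\<close> and
  \<open>|S| = k - 1\<close>, \<open>|T| = k + 1\<close>. Conversely, all such families are cliques.
\<close>

text \<open>Fix distinct members \<open>A\<close> and \<open>B\<close>. If some member
  \<open>C\<close> misses a point \<open>s\<close> of \<open>A \<inter> B\<close>, then a member
  \<open>D\<close> with a point \<open>z\<close> outside \<open>A \<union> B\<close> would have both
  \<open>s\<close> and \<open>z\<close> in \<open>D - C\<close>. The condition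
  \<open>T \<subseteq> \<Union>F\<close> later places \<open>T\<close> among the vertices of the
  graph.\<close>

lemma sunflower_or_cosunflower:
  assumes nonempty: "{} \<notin> F"
    and diff: "\<forall>A\<in>F. \<forall>B\<in>F. A \<noteq> B \<longrightarrow> (\<exists>a. A - B = {a})"
  obtains (star) S where "\<And>A. A \<in> F \<Longrightarrow> \<exists>x. x \<notin> S \<and> A = insert x S"
    | (costar) T where "T \<subseteq> \<Union>F" "\<And>A. A \<in> F \<Longrightarrow> \<exists>x\<in>T. A = T - {x}"
proof (cases "\<exists>A\<in>F. \<exists>B\<in>F. A \<noteq> B")
  case False
  show thesis
  proof (cases "F = {}")
    case True
    then show thesis using star by blast
  next
    case nonempty_F: False
    \<comment> \<open>A lone member is a star around itself minus any one of its points.\<close>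
    then obtain A x where A: "A \<in> F" "x \<in> A"
      using nonempty by (metis all_not_in_conv)
    have "\<exists>y. y \<notin> A - {x} \<and> B = insert y (A - {x})" if "B \<in> F" for B
    proof -
      have "B = A" using False A that by blast
      then show ?thesis using A by (intro exI[of _ x]) auto
    qed
    then show thesis by (rule star)
  qed
next
  case True
  then obtain A B where AB: "A \<in> F" "B \<in> F" "A \<noteq> B" by blast
  obtain a where a: "A - B = {a}" using diff AB by blast
  obtain b where b: "B - A = {b}" using diff AB by blast
  show thesis
  proof (cases "\<forall>C\<in>F. A \<inter> B \<subseteq> C")
    case True
    have "\<exists>x. x \<notin> A \<inter> B \<and> C = insert x (A \<inter> B)" if C: "C \<in> F" for C
    proof (cases "C = A")
      case True
      then show ?thesis using a by (intro exI[of _ a]) auto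
    next
      case False
      obtain c where c: "C - A = {c}" using diff AB C False by blast
      obtain x where x: "A - C = {x}" using diff AB C False by blast
      \<comment> \<open>As \<open>C\<close> keeps \<open>A \<inter> B\<close>, the one point it
        loses from \<open>A\<close> can only be \<open>a\<close>.\<close>
      have "A \<inter> B \<subseteq> C" using True C by blast
      then have "x = a" using a x by auto
      have "C = (A - (A - C)) \<union> (C - A)" by blast
      also have "\<dots> = insert c (A - {a})" unfolding x c \<open>x = a\<close> by simp
      also have "A - {a} = A \<inter> B" unfolding a[symmetric] by blast
      finally show ?thesis using c by (intro exI[of _ c]) auto
    qed
    then show thesis by (rule star)
  next
    case False
    then obtain C s where C: "C \<in> F" and s: "s \<in> A" "s \<in> B" "s \<notin> C" by blast
    have "C \<noteq> A" "C \<noteq> B" using s by auto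
    \<comment> \<open>The point \<open>s\<close> exhausts \<open>B - C\<close>, so \<open>b\<close>
      lies in \<open>C\<close> and is its only point outside \<open>A\<close>.\<close>
    obtain u where "B - C = {u}" using diff AB C \<open>C \<noteq> B\<close> by blast
    then have "B - C = {s}" using s by auto
    obtain c where c: "C - A = {c}" using diff AB C \<open>C \<noteq> A\<close> by blast
    have "b \<in> B" "b \<notin> A" using b by auto
    then have "b \<in> C" using s \<open>B - C = {s}\<close> by auto
    then have "c = b" using \<open>b \<notin> A\<close> c by auto
    have "\<exists>x\<in>A \<union> B. D = A \<union> B - {x}" if D: "D \<in> F" for D
    proof (cases "D = A")
      case True
      then show ?thesis using b by (intro bexI[of _ b]) auto
    next
      case DA: False
      obtain y where y: "A - D = {y}" using diff AB D DA by blast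
      obtain z where z: "D - A = {z}" using diff AB D DA by blast
      show ?thesis
      proof (cases "z \<in> B")
        case True
        then have "z = b" using z b by auto
        have "D = (A - (A - D)) \<union> (D - A)" by blast
        also have "\<dots> = (A - {y}) \<union> (B - A)" unfolding y z b \<open>z = b\<close> by simp
        also have "\<dots> = A \<union> B - {y}" using y by auto
        finally show ?thesis using y by (intro bexI[of _ y]) auto
      next
        case False
        \<comment> \<open>This case is contradictory: \<open>z\<close> exhausts
          \<open>D - B\<close>, so \<open>D\<close> loses \<open>a\<close> from \<open>A\<close> and
          keeps \<open>s\<close>, and then \<open>D - C\<close> has two points.\<close>
        then have "D \<noteq> B" "b \<notin> D" using z b by auto
        obtain w where w: "D - B = {w}" using diff AB D \<open>D \<noteq> B\<close> by blast
        have "z \<notin> A" "a \<in> A" "a \<notin> B" using z a by auto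
        have "z \<in> D - B" using z False by blast
        then have "w = z" using w by simp
        then have "a \<notin> D" using w \<open>a \<in> A\<close> \<open>a \<notin> B\<close> \<open>z \<notin> A\<close> by auto
        then have "a \<in> A - D" using \<open>a \<in> A\<close> by blast
        then have "y = a" using y by simp
        then have "s \<in> D" using y s \<open>a \<notin> B\<close> by auto
        then have "D \<noteq> C" using s by auto
        then obtain v where v: "D - C = {v}" using diff C D by blast
        have "z \<in> D - C" using z c \<open>c = b\<close> \<open>b \<in> B\<close> False by auto
        moreover have "s \<in> D - C" using \<open>s \<in> D\<close> s by auto
        ultimately have "z = s" using v by auto
        then show ?thesis using False s by simp
      qed
    qed
    moreover have "A \<union> B \<subseteq> \<Union>F" using AB by blast
    ultimately show thesis using costar by blast
  qed
qed

text \<open>Splitting the symmetric difference into its two halves yields the singleton differences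
  on which the dichotomy above rests.\<close>

lemma token_graph_arc_iff:
  assumes "pair_graph G"
  shows "(A, B) \<in> parcs (token_graph k G) \<longleftrightarrow>
    A \<in> pverts (token_graph k G) \<and> B \<in> pverts (token_graph k G) \<and>
    (\<exists>a b. A - B = {a} \<and> B - A = {b} \<and> (a, b) \<in> parcs G)"
proof -
  interpret pair_graph G by fact
  have "(\<exists>a\<in>A. \<exists>b\<in>B. sym_diff A B = {a, b} \<and> (a, b) \<in> parcs G) \<longleftrightarrow>
    (\<exists>a b. A - B = {a} \<and> B - A = {b} \<and> (a, b) \<in> parcs G)" (is "?L \<longleftrightarrow> ?R")
  proof
    assume ?L
    then obtain a b where "a \<in> A" "b \<in> B" "sym_diff A B = {a, b}" "(a, b) \<in> parcs G" by blast
    then have "A - B = {a}" "B - A = {b}" by blast+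
    then show ?R using \<open>(a, b) \<in> parcs G\<close> by blast
  next
    assume ?R
    then obtain a b where ab: "A - B = {a}" "B - A = {b}" "(a, b) \<in> parcs G" by blast
    then have "a \<in> A" "b \<in> B" by auto
    moreover have "sym_diff A B = {a, b}" unfolding ab(1,2) by auto
    ultimately show ?L using ab(3) by blast
  qed
  then show ?thesis by (simp add: token_graph_def)
qed

lemma card_le_clique_number:
  assumes "pair_graph G" "is_clique G C"
  shows "card C \<le> clique_number G"
  unfolding clique_number_def
  using is_clique_card_set(1)[OF assms(1)] assms(2) by (intro Max_ge) auto

lemma clique_number_le:
  assumes "pair_graph G" "\<And>C. is_clique G C \<Longrightarrow> card C \<le> m"
  shows "clique_number G \<le> m"
  unfolding clique_number_def
  using is_clique_card_set[OF assms(1)] assms(2) by (subst Max_le_iff) auto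

text \<open>Subsets of cliques are cliques, so every size up to the maximum occurs. The lower bound
  needs this when the clique number is not the smaller term of the minimum.\<close>

lemma obtain_clique:
  assumes "pair_graph G" "m \<le> clique_number G"
  obtains C where "is_clique G C" "card C = m"
proof -
  have "clique_number G \<in> {card C | C. is_clique G C}"
    unfolding clique_number_def by (rule Max_in[OF is_clique_card_set[OF assms(1)]])
  then obtain C where C: "is_clique G C" "card C = clique_number G" by auto
  obtain D where "D \<subseteq> C" "card D = m"
    using obtain_subset_with_card_n[of m C] assms(2) C(2) by metis
  moreover from this have "is_clique G D"
    using C(1) unfolding is_clique_def by blast
  ultimately show thesis using that by blast
qed

lemma inj_on_insert_disjoint: "D \<inter> S = {} \<Longrightarrow> inj_on (\<lambda>x. insert x S) D"
  by (rule inj_onI) blast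

lemma inj_on_remove: "D \<subseteq> T \<Longrightarrow> inj_on (\<lambda>x. T - {x}) D"
  by (rule inj_onI) blast

text \<open>Common core of the two families below. Being an equivalence, it serves the upper bound
  from right-hand family to \<open>D\<close> and the lower bound in the opposite direction.\<close>

lemma is_clique_image_iff:
  assumes inj: "inj_on f D"
    and vert: "\<And>x. x \<in> D \<Longrightarrow> f x \<in> pverts H \<longleftrightarrow> x \<in> pverts G"
    and arc: "\<And>x y. x \<in> D \<Longrightarrow> y \<in> D \<Longrightarrow> x \<noteq> y \<Longrightarrow> x \<in> pverts G \<Longrightarrow> y \<in> pverts G \<Longrightarrow>
      (f x, f y) \<in> parcs H \<longleftrightarrow> (x, y) \<in> parcs G"
  shows "is_clique H (f ` D) \<longleftrightarrow> is_clique G D"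
proof -
  have sub: "f ` D \<subseteq> pverts H \<longleftrightarrow> D \<subseteq> pverts G" using vert by blast
  have "(f x \<noteq> f y \<longrightarrow> (f x, f y) \<in> parcs H) \<longleftrightarrow> (x \<noteq> y \<longrightarrow> (x, y) \<in> parcs G)"
    if "D \<subseteq> pverts G" "x \<in> D" "y \<in> D" for x y
    using arc[of x y] inj_on_eq_iff[OF inj that(2,3)] that by blast
  then show ?thesis unfolding is_clique_def ball_simps sub by blast
qed

text \<open>The tokens on \<open>S\<close> rest while a single token moves along edges of
  \<open>G\<close>.\<close>

lemma is_clique_token_graph_insert:
  assumes G: "pair_graph G" and D: "D \<inter> S = {}"
    and S: "S \<subseteq> pverts G" "card S + 1 = k"
  shows "is_clique (token_graph k G) ((\<lambda>x. insert x S) ` D) \<longleftrightarrow> is_clique G D"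
proof -
  interpret pair_graph G by fact
  have fin: "finite S" using S(1) by (rule finite_subset) simp
  have vert: "insert x S \<in> pverts (token_graph k G) \<longleftrightarrow> x \<in> pverts G" if "x \<in> D" for x
  proof -
    have "x \<notin> S" using that D by blast
    then show ?thesis using S fin by (auto simp: token_graph_def)
  qed
  show ?thesis
  proof (rule is_clique_image_iff[OF inj_on_insert_disjoint[OF D] vert])
    fix x y assume xy: "x \<in> D" "y \<in> D" "x \<noteq> y" "x \<in> pverts G" "y \<in> pverts G"
    then have "insert x S - insert y S = {x}" "insert y S - insert x S = {y}" using D by auto
    then show "(insert x S, insert y S) \<in> parcs (token_graph k G) \<longleftrightarrow> (x, y) \<in> parcs G"
      using xy vert by (simp add: token_graph_arc_iff[OF G])
  qed
qed

text \<open>All vertices of \<open>T\<close> but one carry a token, and the hole moves along edges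
  of \<open>G\<close>.\<close>

lemma is_clique_token_graph_remove:
  assumes G: "pair_graph G" and D: "D \<subseteq> T"
    and T: "T \<subseteq> pverts G" "card T = k + 1"
  shows "is_clique (token_graph k G) ((\<lambda>x. T - {x}) ` D) \<longleftrightarrow> is_clique G D"
proof -
  interpret pair_graph G by fact
  have fin: "finite T" using T(1) by (rule finite_subset) simp
  have vert: "T - {x} \<in> pverts (token_graph k G)" "x \<in> pverts G" if "x \<in> D" for x
    using that D T fin by (auto simp: token_graph_def)
  show ?thesis
  proof (rule is_clique_image_iff[OF inj_on_remove[OF D]])
    fix x assume "x \<in> D"
    then show "T - {x} \<in> pverts (token_graph k G) \<longleftrightarrow> x \<in> pverts G" using vert by simp
  next
    fix x y assume xy: "x \<in> D" "y \<in> D" "x \<noteq> y"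
    \<comment> \<open>A hole going from \<open>x\<close> to \<open>y\<close> is a token going from
      \<open>y\<close> to \<open>x\<close>, so the arc appears reversed and symmetry of
      \<open>G\<close> turns it back.\<close>
    then have "(T - {x}) - (T - {y}) = {y}" "(T - {y}) - (T - {x}) = {x}" using D by auto
    then have "(T - {x}, T - {y}) \<in> parcs (token_graph k G) \<longleftrightarrow> (y, x) \<in> parcs G"
      using xy vert by (simp add: token_graph_arc_iff[OF G])
    also have "\<dots> \<longleftrightarrow> (x, y) \<in> parcs G" using arcs_symmetric by blast
    finally show "(T - {x}, T - {y}) \<in> parcs (token_graph k G) \<longleftrightarrow> (x, y) \<in> parcs G" .
  qed
qed

text \<open>In a star, \<open>D\<close> avoids the \<open>k - 1\<close> vertices of
  \<open>S\<close>; in a costar, \<open>D\<close> lies inside the \<open>k + 1\<close> vertices of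
  \<open>T\<close>. These give the two terms of the maximum.\<close>

lemma card_clique_token_graph_le:
  assumes G: "pair_graph G" and k: "k \<ge> 1" and F: "is_clique (token_graph k G) F"
  shows "card F \<le> min (clique_number G) (max (card (pverts G) - k + 1) (k + 1))"
proof (cases "F = {}")
  case True
  then show ?thesis by simp
next
  case False
  interpret pair_graph G by fact
  have memb: "A \<subseteq> pverts G" "card A = k" "finite A" if "A \<in> F" for A
    using F that finite_subset[of A "pverts G"] by (auto simp: is_clique_def token_graph_def)
  have diff: "\<forall>A\<in>F. \<forall>B\<in>F. A \<noteq> B \<longrightarrow> (\<exists>a. A - B = {a})"
    using F token_graph_arc_iff[OF G] unfolding is_clique_def by meson
  have nonempty: "{} \<notin> F" using memb(2) k by force
  show ?thesis
  proof (cases rule: sunflower_or_cosunflower[OF nonempty diff, case_names star costar])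
    case (star S)
    define D where "D = {x. x \<notin> S \<and> insert x S \<in> F}"
    have disj: "D \<inter> S = {}" and F_eq: "F = (\<lambda>x. insert x S) ` D"
      using star by (auto simp: D_def)
    \<comment> \<open>An actual member of \<open>F\<close> is needed to read off the size of
      \<open>S\<close> and its inclusion in the vertex set.\<close>
    obtain x where "x \<in> D" using False F_eq by auto
    then have x: "x \<notin> S" "insert x S \<in> F" by (auto simp: D_def)
    have S: "S \<subseteq> pverts G" "finite S" "card S + 1 = k"
      using memb[OF x(2)] x(1) by auto
    have D: "is_clique G D"
      using is_clique_token_graph_insert[OF G disj S(1,3)] F F_eq by simp
    then have "D \<subseteq> pverts G - S" using disj by (auto simp: is_clique_def)
    then have "card D \<le> card (pverts G) - card S"
      using card_mono[of "pverts G - S" D] card_Diff_subset[OF S(2,1)] by simp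
    moreover have "card F = card D"
      unfolding F_eq by (rule card_image[OF inj_on_insert_disjoint[OF disj]])
    moreover have "card D \<le> clique_number G" using G D by (rule card_le_clique_number)
    ultimately show ?thesis using S(3) by simp
  next
    case (costar T)
    define D where "D = {x \<in> T. T - {x} \<in> F}"
    have sub: "D \<subseteq> T" and F_eq: "F = (\<lambda>x. T - {x}) ` D"
      using costar(2) by (auto simp: D_def)
    obtain x where "x \<in> D" using False F_eq by auto
    then have x: "x \<in> T" "T - {x} \<in> F" by (auto simp: D_def)
    have T: "T \<subseteq> pverts G" using costar(1) memb(1) by blast
    then have fin: "finite T" by (rule finite_subset) simp
    have cT: "card T = k + 1" using memb(2)[OF x(2)] x(1) fin k by auto
    have "is_clique G D"
      using is_clique_token_graph_remove[OF G sub T cT] F F_eq by simp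
    with G have "card D \<le> clique_number G" by (rule card_le_clique_number)
    moreover have "card D \<le> k + 1" using card_mono[OF fin sub] cT by simp
    moreover have "card F = card D"
      unfolding F_eq by (rule card_image[OF inj_on_remove[OF sub]])
    ultimately show ?thesis by simp
  qed
qed

theorem theorem9:
  fixes G :: "'a pair_pre_digraph" and n k :: nat
  assumes "pair_graph G"
    and "card (pverts G) = n"
    and "k \<ge> 1"
    and "n \<ge> k + 1"
  shows "clique_number (token_graph k G) =
    min (clique_number G) (max (n - k + 1) (k + 1))"
proof (rule antisym)
  show "clique_number (token_graph k G) \<le> min (clique_number G) (max (n - k + 1) (k + 1))"
    using clique_number_le[OF pair_graph_token_graph] card_clique_token_graph_le assms by blast
next
  interpret pair_graph G by fact
  define m where "m = min (clique_number G) (max (n - k + 1) (k + 1))"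
  then obtain D where D: "is_clique G D" "card D = m"
    using obtain_clique[OF assms(1), of m] by auto
  have sub: "D \<subseteq> pverts G" using D(1) by (simp add: is_clique_def)
  then have fin: "finite D" by (rule finite_subset) simp
  \<comment> \<open>Whichever term attains the maximum decides which of the two families is built on
    \<open>D\<close>.\<close>
  consider "m \<le> n - k + 1" | "m \<le> k + 1" unfolding m_def by linarith
  then have "\<exists>F. is_clique (token_graph k G) F \<and> card F = m"
  proof cases
    case 1
    have "card (pverts G - D) = n - m" using card_Diff_subset[OF fin sub] D(2) assms(2) by simp
    \<comment> \<open>The bound on \<open>m\<close> leaves enough vertices outside \<open>D\<close>
      for the resting tokens.\<close>
    then have "k - 1 \<le> card (pverts G - D)" using 1 assms(3,4) by simp
    then obtain S where S: "S \<subseteq> pverts G - D" "card S = k - 1"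
      using obtain_subset_with_card_n by metis
    then have disj: "D \<inter> S = {}" "S \<subseteq> pverts G" "card S + 1 = k" using assms(3) by auto
    have "is_clique (token_graph k G) ((\<lambda>x. insert x S) ` D)"
      using is_clique_token_graph_insert[OF assms(1) disj] D(1) by simp
    then show ?thesis using card_image[OF inj_on_insert_disjoint[OF disj(1)]] D(2) by blast
  next
    case 2
    \<comment> \<open>Such a \<open>T\<close> exists because
      \<open>m \<le> k + 1 \<le> n\<close>.\<close>
    obtain T where T: "D \<subseteq> T" "T \<subseteq> pverts G" "card T = k + 1"
      using exists_subset_between[of D "k + 1" "pverts G"] 2 D(2) sub assms(2,4) by auto
    have "is_clique (token_graph k G) ((\<lambda>x. T - {x}) ` D)"
      using is_clique_token_graph_remove[OF assms(1) T] D(1) by simp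
    then show ?thesis using card_image[OF inj_on_remove[OF T(1)]] D(2) by blast
  qed
  then show "min (clique_number G) (max (n - k + 1) (k + 1)) \<le> clique_number (token_graph k G)"
    using card_le_clique_number[OF pair_graph_token_graph[OF assms(1)]] m_def by metis
qed

end
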